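(* Let $k\ge 1$ and $\mu=(\mu_1,\dots,\mu_k)\in\mathbb{Z}^k$. Then in $\mathrm{NSym}$ $$\mathfrak{S}_{\mu}=\sum_{\gamma\in \mathrm{THC}_{\mu}}\ \prod_{r=1}^k \epsilon(\mathfrak{h}(r,\tau_r))\,H_{\Delta(\mathfrak{h}(r,\tau_r))},$$ where $\mathrm{THC}_\mu$ is the set of tunnel hook coverings $\gamma=(\mathfrak{h}(1,\tau_1),\dots,\mathfrak{h}(k,\tau_k))$ of the diagram of shape $\mu$, $\epsilon(\mathfrak{h}(r,\tau_r))$ and $\Delta(\mathfrak{h}(r,\tau_r))$ are the sign and the integer value assigned to each tunnel hook, and the (noncommutative) product is taken in order from $r=1$ to $r=k$.
   Context: **NSym and immaculate functions.** Let $\mathbf{K}$ be a field of characteristic zero and $\mathrm{NSym}=\mathbf{K}\langle H_1,H_2,\dots\rangle$ the free associative algebra on noncommuting generators $H_i$ of degree $i$. Set $H_0=1$, $H_a=0$ for $a<0$, and $H_{(\alpha_1,\dots,\alpha_k)}=H_{\alpha_1}\cdots H_{\alpha_k}$. The $H_\alpha$, $\alpha$ a composition (finite sequence of positive integers), form a basis. $\mathrm{QSym}$ is the algebra of quasisymmetric functions with monomial basis $M_\beta$, paired with $\mathrm{NSym}$ by $\langle H_\alpha,M_\beta\rangle=\delta_{\alpha,\beta}$. For $F\in\mathrm{QSym}$, $F^\perp$ is the linear operator on $\mathrm{NSym}$ adjoint to multiplication by $F$: $\langle F^\perp X,G\rangle=\langle X,FG\rangle$. Let $F_{1^i}=M_{(1,1,\dots,1)}$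 ($i$ ones) be the fundamental quasisymmetric function indexed by $1^i$. The noncommutative Bernstein operator is $\mathbb{B}_m=\sum_{i\ge0}(-1)^iH_{m+i}F_{1^i}^\perp$ for $m\in\mathbb{Z}$, and the immaculate function of $\mu\in\mathbb{Z}^k$ is $\mathfrak{S}_\mu=\mathbb{B}_{\mu_1}\cdots\mathbb{B}_{\mu_k}(1)$. (It is known from the literature that equivalently $\mathfrak{S}_\mu=\sum_{\sigma\in S_k}\mathrm{sgn}(\sigma)H_{\mu_1-1+\sigma_1}H_{\mu_2-2+\sigma_2}\cdots H_{\mu_k-k+\sigma_k}$.) **Diagrams.** Cells are pairs $(p,q)$ of positive integers: row $p$ (rows numbered from bottom to top), column $q$. Let $0\le s\le k$ and $\nu\in\mathbb{Z}_{\ge0}^k$ with $\nu_{s+1}\ge\dots\ge\nu_k$. The partial GBPR diagram $D^{(s)}_{\mu/\nu}$ has rows $s+1,\dots,k$. In row $i$ the first $\nu_i$ cells are grey; immediately to their right are: $\mu_i-\nu_i$ blue cells if $\mu_i>0$ and $\nu_i\le\mu_i$; $\nu_i-\mu_i$ red cells if $\mu_i>0$ and $\mu_i<\nu_i$; $|\mu_i|+\nu_i$ red cells if $\mu_i\le0$. All other cells are purple. Let $a_i,b_i,c_i$ be the numbers of grey, blue, red cells in row $i$. **Boundary cells, tunnel cells.** For $1\le r\le k$ and $\nu$ with $\nu_r\ge\dots\ge\nu_k$, a cell $(p,q)$ with $r\le p\le k$ is a boundary cell of $D^{(r-1)}_{\mu/\nu}$ iff $\nu_p+1\le q\le\nu_{p-1}+1$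 (when $p>r$), or $\nu_r+1\le q\le\max\{\nu_r+1,a_r+b_r+c_r\}$ (when $p=r$). A tunnel cell is a boundary cell $(p,q)$ with $q=\nu_p+1$. **Tunnel hooks.** For a tunnel cell $\tau=(p,q)$ of $D^{(r-1)}_{\mu/\nu}$, the tunnel hook $\mathfrak{h}(r,\tau)$ is the set of all boundary cells of $D^{(r-1)}_{\mu/\nu}$ in rows $r$ through $p$; $\tau$ is its terminal cell. Its sign is $\epsilon(\mathfrak{h}(r,\tau))=(-1)^{p-r}$, and $\Delta(\mathfrak{h}(r,\tau))=(b_r-c_r)+(\nu_r+1-q)+(p-r)$. **Tunnel hook coverings.** Let $\nu^{(0)}=(0,\dots,0)$. For $r=1,\dots,k$: choose a tunnel hook $\mathfrak{h}(r,\tau_r)$ in $D^{(r-1)}_{\mu/\nu^{(r-1)}}$, and set $\nu^{(r)}_i=\nu^{(r-1)}_i+\#\{\text{cells of }\mathfrak{h}(r,\tau_r)\text{ in row }i\}$ for $1\le i\le k$ (then $\nu^{(r)}_{r+1}\ge\dots\ge\nu^{(r)}_k$, so the process continues). A sequence $\gamma=(\mathfrak{h}(1,\tau_1),\dots,\mathfrak{h}(k,\tau_k))$ arising this way is a tunnel hook covering of the diagram of shape $\mu$; $\mathrm{THC}_\mu$ is the set of all of them. The values $\epsilon,\Delta$ of $\mathfrak{h}(r,\tau_r)$ are computed in $D^{(r-1)}_{\mu/\nu^{(r-1)}}$. *)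

theory Defs
  imports "HOL-Library.Poly_Mapping"
begin

section \<open>Compositions\<close>

typedef composition = "{\<alpha> :: nat list. 0 \<notin> set \<alpha>}"
  morphisms parts Composition
  by (rule exI[of _ "[]"]) simp

instantiation composition :: monoid_add
begin

definition zero_composition :: composition
  where "zero_composition = Composition []"

definition plus_composition :: "composition \<Rightarrow> composition \<Rightarrow> composition"
  where "plus_composition \<alpha> \<beta> = Composition (parts \<alpha> @ parts \<beta>)"

lemma parts_plus: "parts (\<alpha> + \<beta>) = parts \<alpha> @ parts \<beta>"
  using parts[of \<alpha>] parts[of \<beta>]
  by (simp add: plus_composition_def Composition_inverse)

lemma parts_zero: "parts 0 = []"
  by (simp add: zero_composition_def Composition_inverse)

instance
  by standard (simp_all add: parts_inject[symmetric] parts_plus parts_zero)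

end

section \<open>NSym\<close>

text \<open>
  Compositions form, under concatenation, the free monoid on the positive integers. Hence the
  convolution algebra of finitely supported functions on them is the free associative algebra
  on \<open>H\<^sub>1, H\<^sub>2, \<dots>\<close>, and \<open>Poly_Mapping.single \<alpha> 1\<close> is \<open>H\<^sub>\<alpha>\<close>
  (lemma \<open>single_eq_prod_list_H\<close>).
\<close>

type_synonym 'a nsym = "composition \<Rightarrow>\<^sub>0 'a"

definition H :: "int \<Rightarrow> 'a::ring_1 nsym"
  where "H a = (if a < 0 then 0 else if a = 0 then 1
                else Poly_Mapping.single (Composition [nat a]) 1)"

lemma single_eq_prod_list_H:
  "(Poly_Mapping.single \<alpha> 1 :: 'a::ring_1 nsym) = prod_list (map (\<lambda>n. H (int n)) (parts \<alpha>))"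
proof -
  have "(Poly_Mapping.single (Composition xs) 1 :: 'a nsym) = prod_list (map (\<lambda>n. H (int n)) xs)"
    if "0 \<notin> set xs" for xs
    using that
  proof (induction xs)
    case Nil
    then show ?case by (simp flip: zero_composition_def)
  next
    case (Cons x xs)
    have "Composition (x # xs) = Composition [x] + Composition xs"
      using Cons.prems by (simp add: plus_composition_def Composition_inverse)
    then have "(Poly_Mapping.single (Composition (x # xs)) 1 :: 'a nsym) =
      H (int x) * Poly_Mapping.single (Composition xs) 1"
      using Cons.prems by (simp add: H_def mult_single)
    then show ?case
      using Cons by simp
  qed
  from this[of "parts \<alpha>"] show ?thesis
    using parts[of \<alpha>] by (simp add: parts_inverse)
qed

section \<open>QSym\<close>

text \<open>
  A formal power series in commuting variables \<open>x\<^sub>0, x\<^sub>1, \<dots>\<close> is given by its coefficients,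
  a monomial by its exponents.
\<close>

type_synonym monomial = "nat \<Rightarrow>\<^sub>0 nat"
type_synonym 'a power_series = "monomial \<Rightarrow> 'a"

definition series_mult :: "'a::comm_ring_1 power_series \<Rightarrow> 'a power_series \<Rightarrow> 'a power_series"
  where "series_mult F G m = (\<Sum>(u, v) | u + v = m. F u * G v)"

text \<open>\<open>monom_at [j\<^sub>1, \<dots>, j\<^sub>n] [e\<^sub>1, \<dots>, e\<^sub>n]\<close> is the product of the \<open>x\<^bsub>j\<^sub>i\<^esub>\<close> to the power \<open>e\<^sub>i\<close>.\<close>

definition monom_at :: "nat list \<Rightarrow> nat list \<Rightarrow> monomial"
  where "monom_at js es = sum_list (map2 Poly_Mapping.single js es)"

definition total_degree :: "monomial \<Rightarrow> nat"
  where "total_degree m = (\<Sum>v\<in>Poly_Mapping.keys m. Poly_Mapping.lookup m v)"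

definition QSym :: "'a::comm_ring_1 power_series set"
  where "QSym = {F. (\<exists>d. \<forall>m. F m \<noteq> 0 \<longrightarrow> total_degree m \<le> d) \<and>
    (\<forall>\<alpha> is js. sorted_wrt (<) is \<and> length is = length (parts \<alpha>) \<and>
                sorted_wrt (<) js \<and> length js = length (parts \<alpha>) \<longrightarrow>
                F (monom_at is (parts \<alpha>)) = F (monom_at js (parts \<alpha>)))}"

definition M :: "composition \<Rightarrow> 'a::comm_ring_1 power_series"
  where "M \<beta> m = (if \<exists>js. sorted_wrt (<) js \<and> length js = length (parts \<beta>) \<and>
                          m = monom_at js (parts \<beta>) then 1 else 0)"

text \<open>
  The coordinate of a quasisymmetric function at \<open>M \<beta>\<close> is its coefficient at the monomial with
  exponents \<open>\<beta>\<close> in the leading variables; see \<open>M_coord_M\<close> and \<open>QSym_expansion\<close> below.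
\<close>

definition M_coord :: "'a::comm_ring_1 power_series \<Rightarrow> composition \<Rightarrow> 'a"
  where "M_coord G \<beta> = G (monom_at [0..<length (parts \<beta>)] (parts \<beta>))"

definition pairing :: "'a::comm_ring_1 nsym \<Rightarrow> 'a power_series \<Rightarrow> 'a"
  where "pairing X G = (\<Sum>\<alpha>\<in>Poly_Mapping.keys X. Poly_Mapping.lookup X \<alpha> * M_coord G \<alpha>)"

text \<open>Existence and uniqueness of the adjoint are shown in \<open>perp_ex1\<close> below.\<close>

definition perp :: "'a::comm_ring_1 power_series \<Rightarrow> 'a nsym \<Rightarrow> 'a nsym"
  where "perp F X = (THE Y. \<forall>G\<in>QSym. pairing Y G = pairing X (series_mult F G))"

section \<open>Immaculate functions\<close>

definition F_ones :: "nat \<Rightarrow> 'a::comm_ring_1 power_series"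
  where "F_ones i = M (Composition (replicate i 1))"

text \<open>The sum has finite support (lemma \<open>finite_perp_F_ones\<close> below).\<close>

definition bernstein :: "int \<Rightarrow> 'a::comm_ring_1 nsym \<Rightarrow> 'a nsym"
  where "bernstein m X = Sum_any (\<lambda>i. (-1) ^ i * H (m + int i) * perp (F_ones i) X)"

definition immaculate :: "int list \<Rightarrow> 'a::comm_ring_1 nsym"
  where "immaculate \<mu> = List.foldr bernstein \<mu> 1"

section \<open>Diagrams and tunnel hook coverings\<close>

text \<open>Rows are numbered from 1, whereas list positions are numbered from 0.\<close>

type_synonym cell = "nat \<times> nat"

definition row :: "int list \<Rightarrow> nat \<Rightarrow> int"
  where "row \<mu> i = \<mu> ! (i - 1)"

definition grey :: "(nat \<Rightarrow> nat) \<Rightarrow> nat \<Rightarrow> nat"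
  where "grey \<nu> i = \<nu> i"

definition blue :: "int list \<Rightarrow> (nat \<Rightarrow> nat) \<Rightarrow> nat \<Rightarrow> nat"
  where "blue \<mu> \<nu> i =
    (if row \<mu> i > 0 \<and> int (\<nu> i) \<le> row \<mu> i then nat (row \<mu> i - int (\<nu> i)) else 0)"

definition red :: "int list \<Rightarrow> (nat \<Rightarrow> nat) \<Rightarrow> nat \<Rightarrow> nat"
  where "red \<mu> \<nu> i =
    (if row \<mu> i \<le> 0 then nat \<bar>row \<mu> i\<bar> + \<nu> i
     else if row \<mu> i < int (\<nu> i) then nat (int (\<nu> i) - row \<mu> i) else 0)"

text \<open>In the following, \<open>r\<close> refers to the partial diagram with rows \<open>r, \<dots>, k\<close>.\<close>

definition boundary_cell :: "int list \<Rightarrow> (nat \<Rightarrow> nat) \<Rightarrow> nat \<Rightarrow> cell \<Rightarrow> bool"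
  where "boundary_cell \<mu> \<nu> r = (\<lambda>(p, q). r \<le> p \<and> p \<le> length \<mu> \<and> \<nu> p + 1 \<le> q \<and>
    q \<le> (if p = r then max (\<nu> r + 1) (grey \<nu> r + blue \<mu> \<nu> r + red \<mu> \<nu> r)
         else \<nu> (p - 1) + 1))"

definition tunnel_cell :: "int list \<Rightarrow> (nat \<Rightarrow> nat) \<Rightarrow> nat \<Rightarrow> cell \<Rightarrow> bool"
  where "tunnel_cell \<mu> \<nu> r \<tau> \<longleftrightarrow> boundary_cell \<mu> \<nu> r \<tau> \<and> snd \<tau> = \<nu> (fst \<tau>) + 1"

datatype tunnel_hook = Tunnel_Hook (cells: "cell set") (terminal: cell)

definition hook :: "int list \<Rightarrow> (nat \<Rightarrow> nat) \<Rightarrow> nat \<Rightarrow> cell \<Rightarrow> tunnel_hook"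
  where "hook \<mu> \<nu> r \<tau> =
    Tunnel_Hook {c. boundary_cell \<mu> \<nu> r c \<and> r \<le> fst c \<and> fst c \<le> fst \<tau>} \<tau>"

definition hook_sign :: "nat \<Rightarrow> tunnel_hook \<Rightarrow> int"
  where "hook_sign r h = (-1) ^ (fst (terminal h) - r)"

definition hook_value :: "int list \<Rightarrow> (nat \<Rightarrow> nat) \<Rightarrow> nat \<Rightarrow> tunnel_hook \<Rightarrow> int"
  where "hook_value \<mu> \<nu> r h = (case terminal h of (p, q) \<Rightarrow>
    (int (blue \<mu> \<nu> r) - int (red \<mu> \<nu> r)) + (int (\<nu> r) + 1 - int q) + (int p - int r))"

text \<open>\<open>nu \<gamma> r\<close> is \<open>\<nu>\<^bsup>(r)\<^esup>\<close>; the hook chosen at step \<open>r\<close> is \<open>\<gamma> ! (r - 1)\<close>.\<close>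

fun nu :: "tunnel_hook list \<Rightarrow> nat \<Rightarrow> nat \<Rightarrow> nat"
  where
    "nu \<gamma> 0 i = 0"
  | "nu \<gamma> (Suc r) i = nu \<gamma> r i + card {c \<in> cells (\<gamma> ! r). fst c = i}"

definition THC :: "int list \<Rightarrow> tunnel_hook list set"
  where "THC \<mu> = {\<gamma>. length \<gamma> = length \<mu> \<and>
    (\<forall>r\<in>{1..length \<mu>}. \<exists>\<tau>. tunnel_cell \<mu> (nu \<gamma> (r - 1)) r \<tau> \<and>
                              \<gamma> ! (r - 1) = hook \<mu> (nu \<gamma> (r - 1)) r \<tau>)}"

section \<open>Soundness of the definitions\<close>

lemma finite_splittings: "finite {(u, v). u + v = (m :: monomial)}"
proof -
  let ?S = "{g :: nat \<Rightarrow> nat. \<forall>i. (i \<in> Poly_Mapping.keys m \<longrightarrow> g i \<in> {..total_degree m}) \<and>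
                               (i \<notin> Poly_Mapping.keys m \<longrightarrow> g i = 0)}"
  have in_S: "Poly_Mapping.lookup u \<in> ?S" if "u + v = m" for u v
  proof -
    have le: "Poly_Mapping.lookup u i \<le> Poly_Mapping.lookup m i" for i
      unfolding that[symmetric] by (simp add: lookup_add)
    moreover have "Poly_Mapping.lookup m i \<le> total_degree m" if "i \<in> Poly_Mapping.keys m" for i
      unfolding total_degree_def by (rule member_le_sum[OF that]) auto
    ultimately have "Poly_Mapping.lookup u i \<le> total_degree m" if "i \<in> Poly_Mapping.keys m" for i
      using that le_trans by blast
    moreover have "Poly_Mapping.lookup u i = 0" if "i \<notin> Poly_Mapping.keys m" for i
      using le[of i] that by (simp add: in_keys_iff)
    ultimately show ?thesis by simp
  qed
  have "finite ?S"
    by (rule finite_set_of_finite_funs) auto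
  then have fin: "finite (Poly_Mapping.lookup -` ?S)"
    by (rule finite_vimageI) (simp add: inj_on_def poly_mapping.lookup_inject)
  have "{(u, v). u + v = m} \<subseteq> (Poly_Mapping.lookup -` ?S) \<times> (Poly_Mapping.lookup -` ?S)"
  proof (rule subrelI)
    fix u v :: monomial
    assume "(u, v) \<in> {(u, v). u + v = m}"
    then have "u + v = m" "v + u = m"
      by (simp_all add: add.commute)
    then show "(u, v) \<in> (Poly_Mapping.lookup -` ?S) \<times> (Poly_Mapping.lookup -` ?S)"
      by (intro SigmaI vimageI2 in_S)
  qed
  then show ?thesis
    by (rule finite_subset[OF _ finite_SigmaI[OF fin fin]])
qed

lemma lookup_monom_at:
  assumes "distinct js" "length js = length es"
  shows "Poly_Mapping.lookup (monom_at js es) v =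
           (if v \<in> set js then the (map_of (zip js es) v) else 0)"
  using assms(2,1)
  by (induction js es rule: list_induct2)
    (auto simp: monom_at_def lookup_add lookup_single when_def)

lemma monom_at_inject:
  assumes "sorted_wrt (<) is" "length is = length (parts \<alpha>)"
    and "sorted_wrt (<) js" "length js = length (parts \<beta>)"
    and "monom_at is (parts \<alpha>) = monom_at js (parts \<beta>)"
  shows "\<alpha> = \<beta>"
proof -
  have keys: "Poly_Mapping.keys (monom_at ks (parts \<gamma>)) = set ks \<and>
              map (Poly_Mapping.lookup (monom_at ks (parts \<gamma>))) ks = parts \<gamma>"
    if "sorted_wrt (<) ks" "length ks = length (parts \<gamma>)" for ks \<gamma>
  proof
    have d: "distinct ks"
      using that by (simp add: strict_sorted_iff)
    have l: "Poly_Mapping.lookup (monom_at ks (parts \<gamma>)) (ks ! i) = parts \<gamma> ! i"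
      if "i < length ks" for i
      using that d \<open>length ks = length (parts \<gamma>)\<close>
      by (simp add: lookup_monom_at map_of_zip_nth)
    then show "map (Poly_Mapping.lookup (monom_at ks (parts \<gamma>))) ks = parts \<gamma>"
      using that by (intro nth_equalityI) auto
    have "parts \<gamma> ! i \<noteq> 0" if "i < length (parts \<gamma>)" for i
      using parts[of \<gamma>] that by (metis mem_Collect_eq nth_mem)
    then show "Poly_Mapping.keys (monom_at ks (parts \<gamma>)) = set ks"
      using l d that
      by (auto simp: in_keys_iff in_set_conv_nth) (auto simp: lookup_monom_at in_set_conv_nth split: if_splits)
  qed
  have "set is = set js"
    using keys assms by metis
  then have "is = js"
    using assms by (intro sorted_distinct_set_unique) (auto simp: strict_sorted_iff)
  then have "parts \<alpha> = parts \<beta>"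
    using keys assms by metis
  then show ?thesis
    by (simp add: parts_inject)
qed

lemma monom_at_exists:
  fixes m :: monomial
  obtains js \<beta> where "sorted_wrt (<) js" "length js = length (parts \<beta>)" "m = monom_at js (parts \<beta>)"
proof
  let ?js = "sorted_list_of_set (Poly_Mapping.keys m)"
  let ?\<beta> = "Composition (map (Poly_Mapping.lookup m) ?js)"
  have p: "parts ?\<beta> = map (Poly_Mapping.lookup m) ?js"
    by (rule Composition_inverse) (auto simp: in_keys_iff)
  show "sorted_wrt (<) ?js" by simp
  show "length ?js = length (parts ?\<beta>)" by (simp add: p)
  show "m = monom_at ?js (parts ?\<beta>)"
    by (rule poly_mapping_eqI)
      (simp add: p lookup_monom_at map_of_zip_map in_keys_iff)
qed

lemma total_degree_monom_at:
  assumes "sorted_wrt (<) js" "length js = length es"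
  shows "total_degree (monom_at js es) = sum_list es"
proof -
  have d: "distinct js"
    using assms by (simp add: strict_sorted_iff)
  have "total_degree (monom_at js es) = (\<Sum>v\<in>set js. Poly_Mapping.lookup (monom_at js es) v)"
    unfolding total_degree_def
    using d assms by (intro sum.mono_neutral_left) (auto simp: lookup_monom_at in_keys_iff split: if_splits)
  also have "\<dots> = sum_list (map (Poly_Mapping.lookup (monom_at js es)) js)"
    using d by (simp add: sum_list_distinct_conv_sum_set)
  also have "map (Poly_Mapping.lookup (monom_at js es)) js = es"
    using d assms by (intro nth_equalityI) (auto simp: lookup_monom_at map_of_zip_nth)
  finally show ?thesis .
qed

lemma M_monom_at:
  assumes "sorted_wrt (<) js" "length js = length (parts \<alpha>)"
  shows "M \<beta> (monom_at js (parts \<alpha>)) = (if \<alpha> = \<beta> then 1 else 0)"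
  unfolding M_def using assms monom_at_inject[OF assms] by auto

lemma M_in_QSym: "M \<beta> \<in> QSym"
proof -
  have "total_degree m \<le> sum_list (parts \<beta>)" if "M \<beta> m \<noteq> (0 :: 'a)" for m
    using that by (auto simp: M_def total_degree_monom_at split: if_splits)
  then show ?thesis
    by (auto simp: QSym_def M_monom_at)
qed

lemma M_coord_M: "M_coord (M \<beta>) \<alpha> = (if \<alpha> = \<beta> then 1 else 0)"
  unfolding M_coord_def by (subst M_monom_at) (auto simp: strict_sorted_iff)

lemma pairing_H_M:
  "pairing (Poly_Mapping.single \<alpha> 1) (M \<beta> :: 'a::comm_ring_1 power_series) =
     (if \<alpha> = \<beta> then 1 else 0)"
  by (simp add: pairing_def M_coord_M)

lemma QSym_coeff:
  assumes "G \<in> QSym" "sorted_wrt (<) js" "length js = length (parts \<beta>)"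
  shows "G (monom_at js (parts \<beta>)) = M_coord G \<beta>"
  using assms unfolding QSym_def M_coord_def by (auto simp: strict_sorted_iff)

lemma QSym_expansion:
  assumes G: "G \<in> QSym"
  shows "finite {\<beta>. M_coord G \<beta> \<noteq> 0}"
    and "G m = (\<Sum>\<beta> | M_coord G \<beta> \<noteq> 0. M_coord G \<beta> * M \<beta> m)"
proof -
  obtain d where d: "\<And>m. G m \<noteq> 0 \<Longrightarrow> total_degree m \<le> d"
    using G by (auto simp: QSym_def)
  have "parts ` {\<beta>. M_coord G \<beta> \<noteq> 0} \<subseteq> {xs. set xs \<subseteq> {..d} \<and> length xs \<le> d}"
  proof clarify
    fix \<beta> assume "M_coord G \<beta> \<noteq> 0"
    then have s: "sum_list (parts \<beta>) \<le> d"
      using d by (fastforce simp: M_coord_def total_degree_monom_at strict_sorted_iff)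
    have "length xs \<le> sum_list xs" if "0 \<notin> set xs" for xs :: "nat list"
      using that by (induction xs) auto
    then have "length (parts \<beta>) \<le> d"
      using s parts[of \<beta>] by fastforce
    moreover have "x \<le> d" if "x \<in> set (parts \<beta>)" for x
      using s member_le_sum_list[OF that] by simp
    ultimately show "set (parts \<beta>) \<subseteq> {..d} \<and> length (parts \<beta>) \<le> d" by auto
  qed
  then have "finite (parts ` {\<beta>. M_coord G \<beta> \<noteq> 0})"
    by (rule finite_subset) (simp add: finite_lists_length_le)
  then show fin: "finite {\<beta>. M_coord G \<beta> \<noteq> 0}"
    by (rule finite_imageD) (simp add: inj_on_def parts_inject)
  obtain js \<alpha> where m: "sorted_wrt (<) js" "length js = length (parts \<alpha>)" "m = monom_at js (parts \<alpha>)"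
    by (rule monom_at_exists)
  have "(\<Sum>\<beta> | M_coord G \<beta> \<noteq> 0. M_coord G \<beta> * M \<beta> m) =
        (\<Sum>\<beta> | M_coord G \<beta> \<noteq> 0. if \<alpha> = \<beta> then M_coord G \<beta> else 0)"
    using m by (intro sum.cong) (auto simp: M_monom_at)
  also have "\<dots> = M_coord G \<alpha>"
    using fin by (simp add: sum.delta')
  finally show "G m = (\<Sum>\<beta> | M_coord G \<beta> \<noteq> 0. M_coord G \<beta> * M \<beta> m)"
    using QSym_coeff[OF G m(1,2)] m by simp
qed

lemma pairing_superset:
  assumes "finite A" "Poly_Mapping.keys X \<subseteq> A"
  shows "pairing X G = (\<Sum>\<alpha>\<in>A. Poly_Mapping.lookup X \<alpha> * M_coord G \<alpha>)"
  unfolding pairing_def using assms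
  by (intro sum.mono_neutral_left) (auto simp: in_keys_iff)

lemma pairing_add: "pairing (X + Y) G = pairing X G + pairing Y G"
proof -
  let ?A = "Poly_Mapping.keys X \<union> Poly_Mapping.keys Y"
  have "Poly_Mapping.keys (X + Y) \<subseteq> ?A" by (rule Poly_Mapping.keys_add)
  then show ?thesis
    by (simp add: pairing_superset[of ?A] lookup_add distrib_right sum.distrib)
qed

lemma pairing_sum: "pairing (sum f A) G = (\<Sum>x\<in>A. pairing (f x) G)"
  by (induction A rule: infinite_finite_induct) (auto simp: pairing_add, auto simp: pairing_def)

lemma pairing_single: "pairing (Poly_Mapping.single \<alpha> c) G = c * M_coord G \<alpha>"
  by (subst pairing_superset[of "{\<alpha>}"]) auto

lemma pairing_M: "pairing X (M \<beta>) = Poly_Mapping.lookup X \<beta>"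
  by (subst pairing_superset[of "insert \<beta> (Poly_Mapping.keys X)"])
    (auto simp: M_coord_M if_distrib sum.delta cong: if_cong)

lemma perp_ex1: "\<exists>!Y. \<forall>G\<in>QSym. pairing Y G = pairing X (series_mult F G)"
proof (rule ex_ex1I)
  obtain w where w: "\<And>v. \<exists>js. sorted_wrt (<) js \<and> length js = length (parts (w v)) \<and>
                        v = monom_at js (parts (w v))"
    by (metis monom_at_exists)
  let ?x = "\<lambda>\<alpha>. monom_at [0..<length (parts \<alpha>)] (parts \<alpha>)"
  let ?Y = "\<Sum>\<alpha>\<in>Poly_Mapping.keys X. \<Sum>(u, v) | u + v = ?x \<alpha>.
              Poly_Mapping.single (w v) (Poly_Mapping.lookup X \<alpha> * F u)"
  have "pairing ?Y G = pairing X (series_mult F G)" if G: "G \<in> QSym" for G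
  proof -
    have "M_coord G (w v) = G v" for v
      using w[of v] QSym_coeff[OF G] by metis
    then show ?thesis
      by (simp add: pairing_sum case_prod_unfold pairing_single pairing_def[of X] M_coord_def[of "series_mult F G"]
          series_mult_def sum_distrib_left mult.assoc)
  qed
  then show "\<exists>Y. \<forall>G\<in>QSym. pairing Y G = pairing X (series_mult F G)" by blast
next
  fix Y Z :: "'a nsym"
  assume "\<forall>G\<in>QSym. pairing Y G = pairing X (series_mult F G)"
    and "\<forall>G\<in>QSym. pairing Z G = pairing X (series_mult F G)"
  then have "pairing Y (M \<beta>) = pairing Z (M \<beta>)" for \<beta>
    by (simp add: M_in_QSym)
  then show "Y = Z"
    by (intro poly_mapping_eqI) (simp add: pairing_M)
qed

lemma pairing_perp: "G \<in> QSym \<Longrightarrow> pairing (perp F X) G = pairing X (series_mult F G)"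
  using theI'[OF perp_ex1[of X F]] by (simp add: perp_def)

lemma finite_perp_F_ones: "finite {i. perp (F_ones i) X \<noteq> 0}"
proof -
  define L where "L = Max (insert 0 ((\<lambda>\<alpha>. length (parts \<alpha>)) ` Poly_Mapping.keys X))"
  have "perp (F_ones i) X = 0" if i: "i > L" for i
  proof (rule poly_mapping_eqI)
    fix \<beta>
    have "M_coord (series_mult (F_ones i) (M \<beta>)) \<alpha> = (0 :: 'a)" if \<alpha>: "\<alpha> \<in> Poly_Mapping.keys X" for \<alpha>
    proof -
      have len: "length (parts \<alpha>) < i"
        using i \<alpha> unfolding L_def by simp
      have "F_ones i u = (0 :: 'a)" if uv: "u + v = monom_at [0..<length (parts \<alpha>)] (parts \<alpha>)" for u v
      proof (rule ccontr)
        have p: "parts (Composition (replicate i 1)) = replicate i 1"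
          by (rule Composition_inverse) auto
        assume "F_ones i u \<noteq> (0 :: 'a)"
        then obtain js where js: "sorted_wrt (<) js" "length js = i" "u = monom_at js (replicate i 1)"
          unfolding F_ones_def M_def p by (auto split: if_splits)
        have "set js \<subseteq> {0..<length (parts \<alpha>)}"
        proof
          fix j assume j: "j \<in> set js"
          then obtain l where "l < length js" "j = js ! l"
            by (auto simp: in_set_conv_nth)
          then have "Poly_Mapping.lookup u j = 1"
            using js j by (simp add: lookup_monom_at strict_sorted_iff map_of_zip_nth)
          then have "Poly_Mapping.lookup (u + v) j \<noteq> 0"
            by (simp add: lookup_add)
          then show "j \<in> {0..<length (parts \<alpha>)}"
            unfolding uv by (auto simp: lookup_monom_at split: if_splits)
        qed
        then have "card (set js) \<le> length (parts \<alpha>)"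
          using card_mono[of "{0..<length (parts \<alpha>)}"] by simp
        then show False
          using js len by (simp add: distinct_card strict_sorted_iff)
      qed
      then show ?thesis
        unfolding M_coord_def series_mult_def by (intro sum.neutral) auto
    qed
    then have "pairing (perp (F_ones i) X) (M \<beta>) = 0"
      by (simp add: pairing_perp M_in_QSym pairing_def[of X])
    then show "Poly_Mapping.lookup (perp (F_ones i) X) \<beta> = Poly_Mapping.lookup 0 \<beta>"
      by (simp add: pairing_M)
  qed
  then have "{i. perp (F_ones i) X \<noteq> 0} \<subseteq> {..L}"
    by (auto simp: not_less[symmetric])
  then show ?thesis
    by (rule finite_subset) simp
qed

end

theory Submission
  imports Defs
begin

text \<open>
  Both sides of the identity are the same noncommutative Jacobi--Trudi determinant, expanded along
  its rows from top to bottom so that the factors keep their order. Row \<open>r\<close> of this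
  determinant has the entry \<open>H\<close> with index \<open>\<mu>\<^sub>r - r + j\<close> in column \<open>j\<close>. The recursion
  \<open>row_det\<close> deletes the first row and one column at each step.

  The tunnel hooks perform this expansion. In the partial diagram with rows \<open>r, \<dots>, k\<close> there
  is exactly one tunnel cell in each row \<open>p\<close>, at column \<open>\<nu>\<^sub>p + 1\<close>, and its hook has the value
  \<open>\<mu>\<^sub>r - r + (p - \<nu>\<^sub>p)\<close>. So the numbers \<open>p - \<nu>\<^sub>p\<close> label the columns that are still present.
  The hook ending in row \<open>p\<close> changes \<open>\<nu>\<^sub>i\<close> to \<open>\<nu>\<^bsub>i-1\<^esub> + 1\<close> for \<open>r < i \<le> p\<close>, which moves the
  labels before the chosen one by one row and keeps the others: the label \<open>p - \<nu>\<^sub>p\<close> is deleted,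
  and the sign of the hook is the sign of the Laplace expansion (\<open>sum_completions\<close>).

  For the immaculate functions, let \<open>T\<^sub>i\<close> be the adjoint of multiplication by \<open>F\<close> indexed by
  \<open>i\<close> ones. It satisfies the Leibniz rule
  \<open>T\<^sub>i (H\<^sub>a X) = H\<^sub>a T\<^sub>i X + H\<^bsub>a-1\<^esub> T\<^bsub>i-1\<^esub> X\<close> (\<open>perp_F_ones_H_times\<close>). Applied to a determinant, it
  therefore lowers the labels of \<open>i\<close> columns by one, in all possible ways
  (\<open>perp_F_ones_row_det\<close>). If the labels are consecutive, two columns become equal unless
  the lowered columns are the first \<open>i\<close> ones, and determinants with two equal adjacent columns
  vanish (\<open>row_det_eq_columns\<close>). The only surviving term is the minor that goes with
  \<open>(-1)\<^sup>i H\<^bsub>m+i\<^esub>\<close> in the Laplace expansion along a new first row, so the Bernstein operator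
  \<open>B\<^sub>m\<close> adds the row of \<open>m\<close> to the determinant (\<open>bernstein_row_det\<close>).
\<close>

section \<open>Subsets of an interval\<close>

text \<open>
  The order-preserving enumeration of the numbers different from \<open>p\<close>; it renumbers the columns
  of a matrix after the deletion of column \<open>p\<close>.
\<close>

definition skip :: "nat \<Rightarrow> nat \<Rightarrow> nat"
  where "skip p j = (if j < p then j else Suc j)"

definition subsets :: "nat \<Rightarrow> nat \<Rightarrow> nat set set"
  where "subsets n i = {S. S \<subseteq> {..<n} \<and> card S = i}"

lemma finite_subsets: "finite (subsets n i)"
  by (rule finite_subset[of _ "Pow {..<n}"]) (auto simp: subsets_def)

lemma subsets_zero: "subsets n 0 = {{}}"
  by (auto simp: subsets_def dest: finite_subset)

lemma subsets_empty:
  assumes "i > n"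
  shows "subsets n i = {}"
proof -
  have "card S \<noteq> i" if "S \<subseteq> {..<n}" for S
    using card_mono[OF finite_lessThan that] assms by simp
  then show ?thesis
    by (auto simp: subsets_def)
qed

lemma inj_skip: "inj (skip p)"
  by (auto simp: inj_on_def skip_def split: if_splits)

lemma skip_neq: "skip p j \<noteq> p"
  by (simp add: skip_def)

lemma skip_less: "j < n \<Longrightarrow> skip p j < Suc n"
  by (simp add: skip_def)

lemma skip_surj:
  assumes "j \<noteq> p" "j < Suc n" "p \<le> n"
  shows "\<exists>l<n. j = skip p l"
  using assms by (intro exI[of _ "if j < p then j else j - 1"]) (auto simp: skip_def)

text \<open>
  Pascal's rule: a subset either avoids \<open>p\<close>, or it arises from a smaller one by adding \<open>p\<close>. The
  element \<open>p\<close> is arbitrary because every column of the determinant takes its turn as \<open>p\<close>.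
\<close>

lemma sum_subsets_Suc:
  assumes p: "p \<le> n"
  shows "(\<Sum>S\<in>subsets (Suc n) i. f S) = (\<Sum>S\<in>subsets n i. f (skip p ` S)) +
    (if i = 0 then 0 else \<Sum>S\<in>subsets n (i - 1). f (insert p (skip p ` S)))"
proof -
  let ?A = "(`) (skip p) ` subsets n i"
  let ?B = "if i = 0 then {} else (\<lambda>S. insert p (skip p ` S)) ` subsets n (i - 1)"
  have not_in: "p \<notin> skip p ` S" for S
    using skip_neq by (metis imageE)
  have fin: "finite S" if "S \<in> subsets m l" for S m l
    using that finite_subset by (auto simp: subsets_def)
  have card_skip: "card (skip p ` S) = card S" for S
    by (rule card_image) (rule inj_on_subset[OF inj_skip], simp)
  have pre: "\<exists>S'. S' \<subseteq> {..<n} \<and> S = skip p ` S'" if "S \<subseteq> {..<Suc n}" "p \<notin> S" for S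
    using that skip_surj[OF _ _ p]
    by (intro exI[of _ "{l. l < n \<and> skip p l \<in> S}"]) (auto simp: image_iff subset_iff, metis)
  have "subsets (Suc n) i \<subseteq> ?A \<union> ?B"
  proof
    fix S assume S: "S \<in> subsets (Suc n) i"
    show "S \<in> ?A \<union> ?B"
    proof (cases "p \<in> S")
      case False
      then obtain S' where "S' \<subseteq> {..<n}" "S = skip p ` S'"
        using pre[of S] S by (auto simp: subsets_def)
      then show ?thesis
        using S by (auto simp: subsets_def card_skip)
    next
      case True
      then obtain S' where S': "S' \<subseteq> {..<n}" "S - {p} = skip p ` S'"
        using pre[of "S - {p}"] S by (auto simp: subsets_def)
      have "card S' = i - 1"
        using S True card_skip[of S'] unfolding S'(2)[symmetric]
        by (simp add: subsets_def card_Diff_singleton)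
      moreover have "i \<noteq> 0"
        using S True fin[OF S] by (auto simp: subsets_def card_gt_0_iff)
      moreover have "S = insert p (skip p ` S')"
        using S' True by auto
      ultimately show ?thesis
        using S' by (auto simp: subsets_def)
    qed
  qed
  moreover have "?A \<subseteq> subsets (Suc n) i"
    using skip_less by (auto simp: subsets_def card_skip)
  moreover have "insert p (skip p ` S) \<in> subsets (Suc n) i" if "S \<in> subsets n (i - 1)" "i \<noteq> 0" for S
  proof -
    have "skip p ` S \<subseteq> {..<Suc n}"
      using that(1) skip_less by (auto simp: subsets_def)
    moreover have "card (insert p (skip p ` S)) = i"
      using that fin[OF that(1)] not_in[of S] by (simp add: card_skip subsets_def)
    ultimately show ?thesis
      using p by (simp add: subsets_def)
  qed
  then have "?B \<subseteq> subsets (Suc n) i" by auto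
  ultimately have eq: "subsets (Suc n) i = ?A \<union> ?B" by blast
  have inj: "inj_on ((`) (skip p)) X" for X
    using inj_image_eq_iff[OF inj_skip] by (auto simp: inj_on_def)
  have inj': "inj_on (\<lambda>S. insert p (skip p ` S)) X" for X
    using inj_image_eq_iff[OF inj_skip] not_in
    unfolding inj_on_def by (metis insert_ident)
  have "?A \<inter> ?B = {}"
    using not_in by auto (metis insertI1)
  then have "sum f (subsets (Suc n) i) = sum f ?A + sum f ?B"
    unfolding eq by (intro sum.union_disjoint) (auto simp: finite_subsets)
  then show ?thesis
    by (simp add: sum.reindex[OF inj] sum.reindex[OF inj'])
qed

section \<open>The action of the fundamental functions\<close>

text \<open>
  Lowering a part from 1 to 0 removes it from a composition, in accordance with \<open>H\<^sub>0 = 1\<close>.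
\<close>

definition flatten :: "nat list \<Rightarrow> composition"
  where "flatten es = Composition (filter (\<lambda>e. e \<noteq> 0) es)"

lemma parts_flatten: "parts (flatten es) = filter (\<lambda>e. e \<noteq> 0) es"
  unfolding flatten_def by (rule Composition_inverse) auto

lemma flatten_Cons: "flatten (e # es) = flatten [e] + flatten es"
  by (simp add: parts_inject[symmetric] parts_plus parts_flatten)

lemma flatten_parts: "flatten (parts \<alpha>) = \<alpha>"
  using parts[of \<alpha>] by (simp add: parts_inject[symmetric] parts_flatten) (metis filter_True gr0I)

lemma H_int: "H (int e) = Poly_Mapping.single (flatten [e]) 1"
  by (simp add: H_def flatten_def zero_composition_def flip: single_one)

lemma H_times_single: "H (int e) * Poly_Mapping.single \<alpha> c = Poly_Mapping.single (flatten [e] + \<alpha>) c"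
  by (simp add: H_int mult_single)

text \<open>
  A variable with exponent zero does not occur in the monomial, so \<open>M_monom_at\<close> extends to
  exponent lists with zeros.
\<close>

lemma M_monom_at_flatten:
  assumes "sorted_wrt (<) js" "length js = length es"
  shows "M \<beta> (monom_at js es) = (if flatten es = \<beta> then 1 else 0)"
proof -
  let ?z = "filter (\<lambda>x. snd x \<noteq> 0) (zip js es)"
  have snd: "map snd ?z = parts (flatten es)"
    using assms(2) by (simp add: parts_flatten filter_map[symmetric] comp_def)
     (metis (mono_tags, lifting) filter_cong filter_map map_snd_zip comp_apply)
  have "sorted_wrt (<) (map fst (zip js es))"
    using assms by simp
  then have sorted: "sorted_wrt (<) (map fst ?z)"
    unfolding sorted_wrt_map by (rule sorted_wrt_filter)
  have "monom_at js es = monom_at (map fst ?z) (map snd ?z)"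
    unfolding monom_at_def
    by (induction js es rule: list_induct2') auto
  then show ?thesis
    using M_monom_at[OF sorted, of "flatten es" \<beta>] snd by (simp flip: snd)
qed


lemma lookup_perp: "Poly_Mapping.lookup (perp F X) \<beta> = pairing X (series_mult F (M \<beta>))"
  using pairing_perp[OF M_in_QSym, of F X \<beta>] by (simp add: pairing_M)

text \<open>
  The coefficient of the monomial with exponents \<open>\<alpha>\<close> in a product of \<open>F_ones i\<close> with \<open>M \<beta>\<close>
  counts the ways to split off a squarefree monomial of degree \<open>i\<close> such that a monomial of type
  \<open>\<beta>\<close> remains. A squarefree monomial is a set \<open>S\<close> of variables, and it can always be split off
  if its variables occur in the monomial, since then their exponents are positive.
\<close>

lemma perp_F_ones_single:
  fixes c :: "'a::comm_ring_1" and \<alpha> :: composition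
  defines "lowered S \<equiv> map (\<lambda>j. parts \<alpha> ! j - of_bool (j \<in> S)) [0..<length (parts \<alpha>)]"
  shows "perp (F_ones i) (Poly_Mapping.single \<alpha> c) =
    (\<Sum>S\<in>subsets (length (parts \<alpha>)) i. Poly_Mapping.single (flatten (lowered S)) c)"
proof (rule poly_mapping_eqI)
  fix \<beta>
  let ?n = "length (parts \<alpha>)"
  let ?x = "monom_at [0..<?n] (parts \<alpha>)"
  let ?u = "\<lambda>S. monom_at (sorted_list_of_set S) (replicate i 1)"
  let ?v = "\<lambda>S. monom_at [0..<?n] (lowered S)"
  have ones: "parts (Composition (replicate i 1)) = replicate i 1"
    by (rule Composition_inverse) auto
  have pos: "parts \<alpha> ! j > 0" if "j < ?n" for j
    using parts[of \<alpha>] that by (metis (mono_tags) bot_nat_0.not_eq_extremum mem_Collect_eq nth_mem)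
  have fin: "finite S" "card S = i" "S \<subseteq> {..<?n}" if "S \<in> subsets ?n i" for S
    using that finite_subset by (auto simp: subsets_def)
  have lookup_nth: "Poly_Mapping.lookup (monom_at js es) j = es ! l"
    if "distinct js" "length js = length es" "l < length js" "js ! l = j" for js es j l
    using that by (auto simp: lookup_monom_at map_of_zip_nth)
  have lookup_u: "Poly_Mapping.lookup (monom_at js (replicate i 1)) j = of_bool (j \<in> set js)"
    if "distinct js" "length js = i" for js j
  proof (cases "j \<in> set js")
    case True
    then obtain l where "l < length js" "js ! l = j" by (auto simp: in_set_conv_nth)
    then show ?thesis using lookup_nth[of js "replicate i 1" l j] that True by simp
  qed (use that in \<open>simp add: lookup_monom_at\<close>)
  have uS: "Poly_Mapping.lookup (?u S) j = of_bool (j \<in> S)" if "S \<in> subsets ?n i" for S j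
    using fin[OF that] by (subst lookup_u) auto
  \<comment> \<open>Truncated subtraction in \<open>lowered\<close> is harmless because all parts are positive.\<close>
  have uv: "?u S + ?v S = ?x" if S: "S \<in> subsets ?n i" for S
  proof (rule poly_mapping_eqI)
    fix j
    show "Poly_Mapping.lookup (?u S + ?v S) j = Poly_Mapping.lookup ?x j"
    proof (cases "j < ?n")
      case True
      then show ?thesis
        using pos[OF True] lookup_nth[of "[0..<?n]" "parts \<alpha>" j j] lookup_nth[of "[0..<?n]" "lowered S" j j]
        by (auto simp: lookup_add uS[OF S] lowered_def simp del: One_nat_def)
    next
      case False
      then show ?thesis
        using fin[OF S] by (auto simp: lookup_add uS[OF S] lookup_monom_at lowered_def simp del: One_nat_def)
    qed
  qed
  have F_u: "F_ones i (?u S) = (1 :: 'a)" if "S \<in> subsets ?n i" for S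
    using fin[OF that] unfolding F_ones_def M_def ones
    by (auto intro!: exI[of _ "sorted_list_of_set S"] simp del: One_nat_def)
  have supp: "\<exists>S\<in>subsets ?n i. (u, v) = (?u S, ?v S)"
    if uv_x: "u + v = ?x" and F: "F_ones i u \<noteq> (0 :: 'a)" for u v
  proof -
    obtain js where js: "sorted_wrt (<) js" "length js = i" "u = monom_at js (replicate i 1)"
      using F unfolding F_ones_def M_def ones by (auto split: if_splits)
    have "set js \<subseteq> {..<?n}"
    proof
      fix j assume "j \<in> set js"
      then have "Poly_Mapping.lookup (u + v) j \<noteq> 0"
        using js by (simp add: lookup_add lookup_u strict_sorted_iff del: One_nat_def)
      then show "j \<in> {..<?n}"
        unfolding uv_x by (auto simp: lookup_monom_at split: if_splits)
    qed
    then have S: "set js \<in> subsets ?n i"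
      using js by (simp add: subsets_def strict_sorted_iff distinct_card)
    have u: "u = ?u (set js)"
      using js by (simp add: sorted_list_of_set.idem_if_sorted_distinct strict_sorted_iff)
    then have "v = ?v (set js)"
      using uv[OF S] uv_x by (metis add_left_cancel)
    then show ?thesis
      using S u by blast
  qed
  have inj: "inj_on (\<lambda>S. (?u S, ?v S)) (subsets ?n i)"
  proof (rule inj_onI)
    fix S T assume ST: "S \<in> subsets ?n i" "T \<in> subsets ?n i" "(?u S, ?v S) = (?u T, ?v T)"
    then have "(of_bool (j \<in> S) :: nat) = of_bool (j \<in> T)" for j
      using uS[of S j] uS[of T j] by simp
    then show "S = T"
      by (auto simp: of_bool_eq_iff)
  qed
  have "series_mult (F_ones i) (M \<beta>) ?x =
      (\<Sum>(u, v)\<in>(\<lambda>S. (?u S, ?v S)) ` subsets ?n i. F_ones i u * (M \<beta> v :: 'a))"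
    unfolding series_mult_def
  proof (rule sum.mono_neutral_right)
    show "\<forall>w\<in>{(u, v). u + v = ?x} - (\<lambda>S. (?u S, ?v S)) ` subsets ?n i.
        (case w of (u, v) \<Rightarrow> F_ones i u * (M \<beta> v :: 'a)) = 0"
      using supp by fastforce
  qed (use uv finite_splittings in auto)
  also have "\<dots> = (\<Sum>S\<in>subsets ?n i. if flatten (lowered S) = \<beta> then 1 else 0)"
    by (subst sum.reindex[OF inj], intro sum.cong)
      (auto simp: F_u M_monom_at_flatten strict_sorted_iff lowered_def simp del: One_nat_def)
  finally have "M_coord (series_mult (F_ones i) (M \<beta>)) \<alpha> = \<dots>"
    by (simp add: M_coord_def)
  then show "Poly_Mapping.lookup (perp (F_ones i) (Poly_Mapping.single \<alpha> c)) \<beta> =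
      Poly_Mapping.lookup (\<Sum>S\<in>subsets ?n i. Poly_Mapping.single (flatten (lowered S)) c) \<beta>"
    unfolding lookup_perp pairing_single lookup_sum lookup_single when_def
    by (simp add: sum_distrib_left if_distrib cong: if_cong)
qed

lemma perp_add: "perp F (X + Y) = perp F X + perp F Y"
  by (rule poly_mapping_eqI) (simp add: lookup_perp lookup_add pairing_add)

lemma perp_zero: "perp F 0 = 0"
  using perp_add[of F 0 0] by simp

lemma perp_uminus: "perp F (- X) = - perp F X"
  using perp_add[of F X "- X"] by (simp add: perp_zero eq_neg_iff_add_eq_0 add.commute)

lemma perp_sum: "perp F (sum f A) = (\<Sum>x\<in>A. perp F (f x))"
  by (induction A rule: infinite_finite_induct) (auto simp: perp_zero perp_add)

lemma perp_minus_one_power: "perp F ((-1) ^ p * X) = (-1) ^ p * perp F X"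
  by (induction p) (auto simp: perp_uminus)

lemma perp_F_ones_one: "perp (F_ones i) 1 = (if i = 0 then 1 else 0)"
proof -
  have "perp (F_ones i) (Poly_Mapping.single 0 1) =
      (\<Sum>S\<in>subsets 0 i. Poly_Mapping.single (flatten []) (1 :: 'a))"
    using perp_F_ones_single[of i 0 1] unfolding parts_zero by simp
  moreover have "flatten [] = 0"
    using flatten_parts[of 0] by (simp add: parts_zero)
  ultimately show ?thesis
    by (cases "i = 0") (simp_all add: subsets_zero subsets_empty)
qed

text \<open>For identities whose two sides are additive in \<open>X\<close>.\<close>

lemma nsym_additive_induct [case_names single zero add]:
  assumes single: "\<And>\<alpha> c. P (Poly_Mapping.single \<alpha> c)"
    and zero: "P 0" and add: "\<And>X Y. P X \<Longrightarrow> P Y \<Longrightarrow> P (X + Y)"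
  shows "P (X :: 'a::comm_ring_1 nsym)"
proof -
  have X: "X = (\<Sum>\<alpha>\<in>Poly_Mapping.keys X. Poly_Mapping.single \<alpha> (Poly_Mapping.lookup X \<alpha>))"
    by (rule poly_mapping_eqI) (simp add: lookup_sum lookup_single when_def in_keys_iff)
  have "P (\<Sum>\<alpha>\<in>A. Poly_Mapping.single \<alpha> (Poly_Mapping.lookup X \<alpha>))" for A
    by (induction A rule: infinite_finite_induct) (auto intro: assms)
  then show ?thesis
    using X by metis
qed

text \<open>
  For a positive index, the two terms collect the subsets without and with the first part in
  \<open>perp_F_ones_single\<close>. The conventions \<open>H\<^sub>0 = 1\<close> and \<open>H\<^sub>a = 0\<close> for negative \<open>a\<close> make the rule
  true for all integers, which spares case distinctions for the entries of the determinant.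
\<close>

lemma perp_F_ones_H_times:
  "perp (F_ones i) (H a * X) = H a * perp (F_ones i) X +
     (if i = 0 then 0 else H (a - 1) * perp (F_ones (i - 1)) X)"
proof -
  consider "a < 0" | "a = 0" | e where "a = int (Suc e)"
    by (metis not_less_iff_gr_or_eq zero_less_imp_eq_int gr0_implies_Suc)
  then show ?thesis
  proof cases
    case 3
    let ?a = "Composition [Suc e]"
    have pa: "parts ?a = [Suc e]" "?a = flatten [Suc e]"
      by (simp_all add: Composition_inverse flatten_def)
    show ?thesis
    proof (induction X rule: nsym_additive_induct)
      case (single \<alpha> c)
      let ?n = "length (parts \<alpha>)"
      let ?m = "\<lambda>S. map (\<lambda>j. parts \<alpha> ! j - of_bool (j \<in> S)) [0..<?n]"
      have p: "parts (flatten [Suc e] + \<alpha>) = Suc e # parts \<alpha>"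
        by (simp add: parts_plus parts_flatten)
      have upt: "[0..<Suc ?n] = 0 # map Suc [0..<?n]"
        by (simp add: upt_conv_Cons map_Suc_upt del: upt_Suc)
      have skip0: "skip 0 ` S = Suc ` S" for S
        by (auto simp: skip_def)
      have shift: "map (\<lambda>j. (Suc e # parts \<alpha>) ! j - of_bool (j \<in> S)) [0..<Suc ?n] =
          (Suc e - of_bool (0 \<in> S)) # ?m (Suc -` S)" for S
        unfolding upt by (simp add: vimage_def)
      have v: "Suc -` (Suc ` S) = S" "Suc -` insert 0 (Suc ` S) = S" for S
        by auto
      have H: "H (int k) * (\<Sum>S\<in>T. Poly_Mapping.single (flatten (?m S)) c) =
          (\<Sum>S\<in>T. Poly_Mapping.single (flatten (k # ?m S)) c)" for k T
        by (simp add: sum_distrib_left H_times_single flip: flatten_Cons)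
      have "perp (F_ones i) (H (int (Suc e)) * Poly_Mapping.single \<alpha> c) =
          perp (F_ones i) (Poly_Mapping.single (flatten [Suc e] + \<alpha>) c)"
        by (subst H_times_single) rule
      also have "\<dots> = (\<Sum>S\<in>subsets (Suc ?n) i.
          Poly_Mapping.single (flatten ((Suc e - of_bool (0 \<in> S)) # ?m (Suc -` S))) c)"
        unfolding perp_F_ones_single p length_Cons shift ..
      also have "\<dots> = (\<Sum>S\<in>subsets ?n i. Poly_Mapping.single (flatten (Suc e # ?m S)) c) +
          (if i = 0 then 0 else
             \<Sum>S\<in>subsets ?n (i - 1). Poly_Mapping.single (flatten (e # ?m S)) c)"
        unfolding sum_subsets_Suc[OF le0] skip0 v by (simp add: image_iff)
      also have "\<dots> = H (int (Suc e)) * perp (F_ones i) (Poly_Mapping.single \<alpha> c) +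
          (if i = 0 then 0 else H (int e) * perp (F_ones (i - 1)) (Poly_Mapping.single \<alpha> c))"
        unfolding perp_F_ones_single H ..
      finally show ?case
        using 3 by simp
    qed (auto simp: perp_zero perp_add distrib_left)
  qed (auto simp: H_def perp_zero)
qed

section \<open>The determinant\<close>

text \<open>
  Column \<open>j\<close> is given by the label \<open>x j\<close>, where \<open>j\<close> ranges over the numbers below the length
  of \<open>\<mu>\<close>. The subtraction of 1 in the minor accounts for the row number in the index
  \<open>\<mu>\<^sub>r - r + j\<close>: with \<open>x = int\<close>, both rows and columns count from zero.
\<close>

fun row_det :: "int list \<Rightarrow> (nat \<Rightarrow> int) \<Rightarrow> 'a::comm_ring_1 nsym"
  where
    "row_det [] x = 1"
  | "row_det (m # \<mu>) x =
      (\<Sum>p\<le>length \<mu>. (-1) ^ p * (H (m + x p) * row_det \<mu> (\<lambda>j. x (skip p j) - 1)))"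

text \<open>
  By the Leibniz rule, each product in the expansion of the determinant gives the products in
  which \<open>i\<close> of its factors have their index lowered. A set of rows to be lowered corresponds,
  in each product, to the set \<open>S\<close> of the columns chosen in these rows; sorted by \<open>S\<close>, the
  products form determinants again.
\<close>

lemma perp_F_ones_row_det:
  "perp (F_ones i) (row_det \<mu> x :: 'a::comm_ring_1 nsym) =
     (\<Sum>S\<in>subsets (length \<mu>) i. row_det \<mu> (\<lambda>j. x j - of_bool (j \<in> S)))"
proof (induction \<mu> arbitrary: x i)
  case Nil
  then show ?case
    by (simp add: perp_F_ones_one subsets_zero subsets_empty)
next
  case (Cons m \<mu>)
  let ?n = "length \<mu>"
  have mem: "skip p j \<in> skip p ` S \<longleftrightarrow> j \<in> S" "p \<notin> skip p ` S" for p j S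
    using inj_image_mem_iff[OF inj_skip] skip_neq by (simp, metis imageE)
  \<comment> \<open>Pascal's rule at the column \<open>p\<close> of the first factor matches the Leibniz rule.\<close>
  have col: "(\<Sum>S\<in>subsets (Suc ?n) i. H (m + (x p - of_bool (p \<in> S))) *
        row_det \<mu> (\<lambda>j. x (skip p j) - of_bool (skip p j \<in> S) - 1)) =
      perp (F_ones i) (H (m + x p) * row_det \<mu> (\<lambda>j. x (skip p j) - 1) :: 'a nsym)" if "p \<le> ?n" for p
    unfolding sum_subsets_Suc[OF that] perp_F_ones_H_times Cons
    by (simp add: mem skip_neq sum_distrib_left algebra_simps)
  have "(\<Sum>S\<in>subsets (length (m # \<mu>)) i. row_det (m # \<mu>) (\<lambda>j. x j - of_bool (j \<in> S)) :: 'a nsym) =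
      (\<Sum>p\<le>?n. (-1) ^ p * (\<Sum>S\<in>subsets (Suc ?n) i. H (m + (x p - of_bool (p \<in> S))) *
        row_det \<mu> (\<lambda>j. x (skip p j) - of_bool (skip p j \<in> S) - 1)))"
    by (simp add: sum_distrib_left) (rule sum.swap)
  also have "\<dots> = perp (F_ones i) (row_det (m # \<mu>) x)"
    by (simp add: perp_sum perp_minus_one_power col)
  finally show ?case ..
qed

text \<open>
  Deleting either of the two equal columns leaves the same minor, with opposite signs; every
  other minor still has two equal adjacent columns.
\<close>

lemma row_det_eq_columns:
  assumes "Suc q < length \<mu>" "x q = x (Suc q)"
  shows "row_det \<mu> x = 0"
  using assms
proof (induction \<mu> arbitrary: x q)
  case (Cons m \<mu>)
  let ?t = "\<lambda>p. (-1) ^ p * (H (m + x p) * row_det \<mu> (\<lambda>j. x (skip p j) - 1)) :: 'a nsym"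
  have "(\<lambda>j. x (skip q j) - 1) = (\<lambda>j. x (skip (Suc q) j) - 1)"
    using Cons.prems(2) by (auto simp: skip_def fun_eq_iff less_Suc_eq)
  then have pair: "?t q + ?t (Suc q) = 0"
    using Cons.prems(2) by simp
  have other: "?t p = 0" if "p \<le> length \<mu>" "p \<noteq> q" "p \<noteq> Suc q" for p
  proof -
    let ?q = "if p < q then q - 1 else q"
    have "row_det \<mu> (\<lambda>j. x (skip p j) - 1) = (0 :: 'a nsym)"
      using that Cons.prems by (intro Cons.IH[of ?q]) (auto simp: skip_def)
    then show ?thesis by simp
  qed
  have "row_det (m # \<mu>) x = (\<Sum>p\<in>{q, Suc q}. ?t p)"
    unfolding row_det.simps using Cons.prems(1) other by (intro sum.mono_neutral_right) auto
  then show ?case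
    using pair by simp
qed simp

lemma initial_segment:
  assumes "S \<in> subsets n i" "\<And>q. Suc q \<in> S \<Longrightarrow> q \<in> S"
  shows "S = {..<i}"
proof -
  have fin: "finite S" "card S = i"
    using assms(1) finite_subset by (auto simp: subsets_def)
  have down: "b \<in> S" if "b \<le> a" "a \<in> S" for a b
    using that by (induction rule: inc_induct) (auto intro: assms(2))
  have "\<exists>l. S = {..<l}"
  proof (cases "S = {}")
    case False
    then have "S = {..<Suc (Max S)}"
      using fin Max_ge[OF fin(1)] Max_in[OF fin(1)] down by (fastforce simp: less_Suc_eq_le)
    then show ?thesis ..
  qed auto
  then show ?thesis
    using fin by auto
qed

text \<open>
  If \<open>S\<close> is not an initial segment, it contains some \<open>q + 1\<close> without \<open>q\<close>, and lowering column
  \<open>q + 1\<close> makes it equal to column \<open>q\<close>. Lowering the first \<open>i\<close> columns gives the labels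
  \<open>-1, \<dots>, i - 2, i, i + 1, \<dots>\<close>, which are those of the minor for column \<open>i\<close>.
\<close>

lemma perp_F_ones_row_det_int:
  "perp (F_ones i) (row_det \<mu> int) =
     (if i \<le> length \<mu> then row_det \<mu> (\<lambda>j. int (skip i j) - 1) else 0)"
proof (cases "i \<le> length \<mu>")
  case True
  let ?f = "\<lambda>S. row_det \<mu> (\<lambda>j. int j - of_bool (j \<in> S)) :: 'a nsym"
  have "?f S = 0" if S: "S \<in> subsets (length \<mu>) i" "S \<noteq> {..<i}" for S
  proof -
    obtain q where q: "Suc q \<in> S" "q \<notin> S"
      using initial_segment[OF S(1)] S(2) by blast
    show ?thesis
      using q S(1) by (intro row_det_eq_columns[of q]) (auto simp: subsets_def)
  qed
  then have "perp (F_ones i) (row_det \<mu> int) = sum ?f {{..<i}}"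
    unfolding perp_F_ones_row_det using True
    by (intro sum.mono_neutral_right) (auto simp: finite_subsets subsets_def)
  also have "\<dots> = row_det \<mu> (\<lambda>j. int (skip i j) - 1)"
    by (simp, intro arg_cong[of _ _ "row_det \<mu>"]) (auto simp: skip_def fun_eq_iff)
  finally show ?thesis
    using True by simp
qed (simp add: perp_F_ones_row_det subsets_empty)

lemma bernstein_row_det: "bernstein m (row_det \<mu> int) = row_det (m # \<mu>) int"
proof -
  have "bernstein m (row_det \<mu> int) =
      (\<Sum>i\<le>length \<mu>. (-1) ^ i * H (m + int i) * perp (F_ones i) (row_det \<mu> int))"
    unfolding bernstein_def
    by (rule Sum_any.expand_superset) (auto simp: perp_F_ones_row_det_int)
  then show ?thesis
    by (simp add: perp_F_ones_row_det_int mult.assoc)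
qed

lemma immaculate_eq_row_det: "immaculate \<mu> = row_det \<mu> int"
  by (induction \<mu>) (simp_all add: immaculate_def bernstein_row_det del: row_det.simps(2))


section \<open>Tunnel hook coverings\<close>

text \<open>
  The column labels \<open>p - \<nu>\<^sub>p\<close> of the rows \<open>p = r + j\<close> still present, lowered by \<open>r\<close> in accordance
  with the subtraction of 1 in each minor of \<open>row_det\<close>.
\<close>

definition columns_of :: "(nat \<Rightarrow> nat) \<Rightarrow> nat \<Rightarrow> nat \<Rightarrow> int"
  where "columns_of \<nu> r j = int j - int (\<nu> (r + j))"

definition descending :: "nat \<Rightarrow> nat \<Rightarrow> (nat \<Rightarrow> nat) \<Rightarrow> bool"
  where "descending r k \<nu> \<longleftrightarrow> (\<forall>i. r < i \<and> i \<le> k \<longrightarrow> \<nu> i \<le> \<nu> (i - 1))"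

text \<open>
  The rows weakly decrease, so the interval of boundary cells of each row is nonempty and starts
  with its tunnel cell.
\<close>

lemma tunnel_cell_iff:
  assumes "descending r (length \<mu>) \<nu>"
  shows "tunnel_cell \<mu> \<nu> r (p, q) \<longleftrightarrow> r \<le> p \<and> p \<le> length \<mu> \<and> q = \<nu> p + 1"
proof -
  have "\<nu> p \<le> \<nu> (p - 1)" if "r \<le> p" "p \<noteq> r" "p \<le> length \<mu>"
    using assms that by (simp add: descending_def)
  then show ?thesis
    by (auto simp: tunnel_cell_def boundary_cell_def)
qed

text \<open>
  In all three cases of the colouring, the blue cells minus the red cells of row \<open>r\<close> number
  \<open>\<mu>\<^sub>r - \<nu>\<^sub>r\<close>, so \<open>\<nu>\<^sub>r\<close> cancels.
\<close>

lemma hook_value_tunnel: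
  "hook_value \<mu> \<nu> r (hook \<mu> \<nu> r (p, \<nu> p + 1)) = row \<mu> r - int (\<nu> p) + int p - int r"
  by (auto simp: hook_value_def hook_def blue_def red_def)

text \<open>
  Row \<open>r\<close> itself, where the upper end of the boundary depends on the colours, is left out: it
  does not belong to the later partial diagrams.
\<close>

lemma card_hook_row:
  assumes "r < i" "p \<le> length \<mu>"
  shows "card {c \<in> cells (hook \<mu> \<nu> r (p, q)). fst c = i} =
    (if i \<le> p then \<nu> (i - 1) + 1 - \<nu> i else 0)"
proof -
  have "{c \<in> cells (hook \<mu> \<nu> r (p, q)). fst c = i} =
      (if i \<le> p then {i} \<times> {\<nu> i + 1..\<nu> (i - 1) + 1} else {})"
    using assms by (auto simp: hook_def boundary_cell_def)
  then show ?thesis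
    by (simp add: card_cartesian_product_singleton)
qed

lemma nu_cong:
  assumes "\<And>i. i < r \<Longrightarrow> \<gamma> ! i = \<delta> ! i"
  shows "nu \<gamma> r = nu \<delta> r"
  using assms by (induction r) (auto simp: fun_eq_iff)

definition partial_covering :: "int list \<Rightarrow> tunnel_hook list \<Rightarrow> bool"
  where "partial_covering \<mu> \<delta> \<longleftrightarrow> length \<delta> \<le> length \<mu> \<and>
    (\<forall>r<length \<delta>. \<exists>\<tau>. tunnel_cell \<mu> (nu \<delta> r) (Suc r) \<tau> \<and> \<delta> ! r = hook \<mu> (nu \<delta> r) (Suc r) \<tau>)"

text \<open>
  The coverings that begin with given hooks; summing over them makes the sum over all coverings
  accessible to induction, one hook at a time.
\<close>

definition completions :: "int list \<Rightarrow> tunnel_hook list \<Rightarrow> tunnel_hook list set"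
  where "completions \<mu> \<delta> = {\<gamma> \<in> THC \<mu>. take (length \<delta>) \<gamma> = \<delta>}"

lemma THC_iff: "\<gamma> \<in> THC \<mu> \<longleftrightarrow> length \<gamma> = length \<mu> \<and> partial_covering \<mu> \<gamma>"
proof -
  have "{1..length \<mu>} = Suc ` {..<length \<mu>}"
    by (auto simp: image_iff Suc_le_eq gr0_conv_Suc)
  then show ?thesis
    by (auto simp: THC_def partial_covering_def)
qed

lemma THC_empty_completions: "THC \<mu> = completions \<mu> []"
  by (simp add: completions_def)

lemma hook_inject: "hook \<mu> \<nu> r \<tau> = hook \<mu> \<nu> r \<tau>' \<longleftrightarrow> \<tau> = \<tau>'"
  by (auto simp: hook_def)

text \<open>
  The remaining hooks expand the minor that is left of the determinant: the choice of the next
  hook, ending in row \<open>r + 1 + p\<close>, is the choice of column \<open>p\<close> in the Laplace expansion. The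
  finiteness claim is part of the induction, since a sum over an infinite set would be zero.
\<close>

lemma sum_completions:
  assumes "partial_covering \<mu> \<delta>" "descending (Suc (length \<delta>)) (length \<mu>) (nu \<delta> (length \<delta>))"
  shows "finite (completions \<mu> \<delta>) \<and>
    (\<Sum>\<gamma>\<in>completions \<mu> \<delta>. prod_list (map (\<lambda>r. of_int (hook_sign r (\<gamma> ! (r - 1))) *
       H (hook_value \<mu> (nu \<gamma> (r - 1)) r (\<gamma> ! (r - 1)))) [length \<delta> + 1..<length \<mu> + 1])) =
    (row_det (drop (length \<delta>) \<mu>) (columns_of (nu \<delta> (length \<delta>)) (Suc (length \<delta>))) :: 'a::comm_ring_1 nsym)"
  using assms
proof (induction "length \<mu> - length \<delta>" arbitrary: \<delta>)
  case 0
  then have len: "length \<delta> = length \<mu>"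
    by (simp add: partial_covering_def)
  then have "completions \<mu> \<delta> = {\<delta>}"
    using 0 by (auto simp: completions_def THC_iff)
  then show ?case
    using len by simp
next
  case (Suc l)
  define r where "r = length \<delta>"
  define n where "n = length (drop (Suc r) \<mu>)"
  define \<nu> where "\<nu> = nu \<delta> r"
  define h where "h p = hook \<mu> \<nu> (Suc r) (Suc r + p, \<nu> (Suc r + p) + 1)" for p
  let ?w = "\<lambda>\<gamma> r. of_int (hook_sign r (\<gamma> ! (r - 1))) *
       H (hook_value \<mu> (nu \<gamma> (r - 1)) r (\<gamma> ! (r - 1))) :: 'a nsym"
  have r: "r < length \<mu>" and l: "l = length \<mu> - Suc r"
    using Suc.hyps(2) by (auto simp: r_def)
  have n: "length \<mu> = Suc r + n"
    using r by (simp add: n_def)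
  have desc: "descending (Suc r) (length \<mu>) \<nu>"
    using Suc.prems by (simp add: r_def \<nu>_def)
  have tc: "tunnel_cell \<mu> \<nu> (Suc r) (a, b) \<longleftrightarrow> (\<exists>p\<le>n. a = Suc r + p \<and> b = \<nu> (Suc r + p) + 1)" for a b
    unfolding tunnel_cell_iff[OF desc] n by (auto simp: le_iff_add)
  have nu_app: "nu (\<delta> @ \<epsilon>) r' = nu \<delta> r'" if "r' \<le> r" for \<epsilon> r'
    using that by (intro nu_cong) (auto simp: r_def nth_append)
  have partial: "partial_covering \<mu> (\<delta> @ [h p])" if "p \<le> n" for p
    using Suc.prems(1) r that tc unfolding partial_covering_def
    by (auto simp: less_Suc_eq nth_append nu_app h_def \<nu>_def simp flip: r_def)
  \<comment> \<open>Each row that the hook passes becomes one cell longer than the old row below it.\<close>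
  have nu_row: "nu (\<delta> @ [h p]) (Suc r) i = (if i \<le> Suc r + p then \<nu> (i - 1) + 1 else \<nu> i)"
    if p: "p \<le> n" and i: "Suc r < i" for p i
  proof -
    have "\<nu> i \<le> \<nu> (i - 1)" if "i \<le> Suc r + p"
      using desc that i p n by (simp add: descending_def)
    moreover have "nu (\<delta> @ [h p]) (Suc r) i = \<nu> i + card {c \<in> cells (h p). fst c = i}"
      by (simp add: nu_app \<nu>_def) (simp add: r_def)
    ultimately show ?thesis
      using p n by (auto simp: h_def card_hook_row[OF i] simp del: nu.simps)
  qed
  have desc': "descending (Suc (Suc r)) (length \<mu>) (nu (\<delta> @ [h p]) (Suc r))" if p: "p \<le> n" for p
    unfolding descending_def
  proof (intro allI impI)
    fix i assume i: "Suc (Suc r) < i \<and> i \<le> length \<mu>"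
    then have rows: "Suc r < i \<and> i \<le> length \<mu>" "Suc r < i - 1 \<and> i - 1 \<le> length \<mu>"
      by linarith+
    then have "\<nu> i \<le> \<nu> (i - 1)" "\<nu> (i - 1) \<le> \<nu> (i - 1 - 1)"
      using desc unfolding descending_def by blast+
    then show "nu (\<delta> @ [h p]) (Suc r) i \<le> nu (\<delta> @ [h p]) (Suc r) (i - 1)"
      unfolding nu_row[OF p rows(1)[THEN conjunct1]] nu_row[OF p rows(2)[THEN conjunct1]] by auto
  qed
  \<comment> \<open>The step from \<open>\<nu>\<close> to its successor deletes the label of column \<open>p\<close>.\<close>
  have x: "columns_of (nu (\<delta> @ [h p]) (Suc r)) (Suc (Suc r)) = (\<lambda>j. columns_of \<nu> (Suc r) (skip p j) - 1)"
    if "p \<le> n" for p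
    using that by (auto simp: fun_eq_iff columns_of_def nu_row skip_def simp del: nu.simps)
  have IH: "finite (completions \<mu> (\<delta> @ [h p]))"
    "(\<Sum>\<gamma>\<in>completions \<mu> (\<delta> @ [h p]). prod_list (map (?w \<gamma>) [r + 2..<length \<mu> + 1])) =
      row_det (drop (Suc r) \<mu>) (\<lambda>j. columns_of \<nu> (Suc r) (skip p j) - 1)" if "p \<le> n" for p
    using Suc.hyps(1)[of "\<delta> @ [h p]"] l partial[OF that] desc'[OF that] x[OF that]
    by (simp_all del: nu.simps flip: r_def)
  have first: "?w \<gamma> (Suc r) = (-1) ^ p * H (\<mu> ! r + columns_of \<nu> (Suc r) p)"
    if "\<gamma> \<in> completions \<mu> (\<delta> @ [h p])" for \<gamma> p
  proof -
    have "take (Suc r) \<gamma> = \<delta> @ [h p]"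
      using that by (simp add: completions_def r_def)
    then have \<gamma>: "\<gamma> = \<delta> @ h p # drop (Suc r) \<gamma>"
      using append_take_drop_id[of "Suc r" \<gamma>] by simp
    have "\<gamma> ! r = h p" "nu \<gamma> r = \<nu>"
      by (subst \<gamma>, simp add: r_def nu_app \<nu>_def)+
    then show ?thesis
      unfolding diff_Suc_1 \<open>\<gamma> ! r = h p\<close> \<open>nu \<gamma> r = \<nu>\<close> h_def hook_value_tunnel
      by (simp add: hook_sign_def hook_def row_def columns_of_def algebra_simps)
  qed
  have "completions \<mu> \<delta> = (\<Union>p\<le>n. completions \<mu> (\<delta> @ [h p]))"
  proof (intro set_eqI iffI)
    fix \<gamma> assume "\<gamma> \<in> completions \<mu> \<delta>"
    then have \<gamma>: "\<gamma> \<in> THC \<mu>" "take r \<gamma> = \<delta>"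
      by (auto simp: completions_def r_def)
    then have len: "length \<gamma> = length \<mu>"
      by (simp add: THC_iff)
    obtain \<epsilon> where \<epsilon>: "\<gamma> = \<delta> @ \<epsilon>"
      using \<gamma>(2) append_take_drop_id[of r \<gamma>] by metis
    have "\<exists>\<tau>. tunnel_cell \<mu> \<nu> (Suc r) \<tau> \<and> \<gamma> ! r = hook \<mu> \<nu> (Suc r) \<tau>"
      using \<gamma>(1) len r unfolding THC_iff partial_covering_def \<epsilon> \<nu>_def
      by (metis nu_app order_refl)
    then obtain p where "p \<le> n" "\<gamma> ! r = h p"
      unfolding split_paired_Ex tc h_def by auto
    moreover have "take (Suc r) \<gamma> = \<delta> @ [\<gamma> ! r]"
      using \<gamma>(2) len r by (simp add: take_Suc_conv_app_nth)
    ultimately show "\<gamma> \<in> (\<Union>p\<le>n. completions \<mu> (\<delta> @ [h p]))"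
      using \<gamma>(1) by (auto simp: completions_def simp flip: r_def)
  next
    fix \<gamma> assume "\<gamma> \<in> (\<Union>p\<le>n. completions \<mu> (\<delta> @ [h p]))"
    then obtain p where "\<gamma> \<in> THC \<mu>" "take (Suc r) \<gamma> = \<delta> @ [h p]"
      by (auto simp: completions_def simp flip: r_def)
    then show "\<gamma> \<in> completions \<mu> \<delta>"
      using take_take[of r "Suc r" \<gamma>] by (simp add: completions_def r_def)
  qed
  moreover have "h p \<noteq> h p'" if "p \<noteq> p'" for p p'
    using that by (simp add: h_def hook_inject)
  then have "completions \<mu> (\<delta> @ [h p]) \<inter> completions \<mu> (\<delta> @ [h p']) = {}" if "p \<noteq> p'" for p p'
    using that by (auto simp: completions_def)
  ultimately have "finite (completions \<mu> \<delta>)"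
    and sum: "(\<Sum>\<gamma>\<in>completions \<mu> \<delta>. prod_list (map (?w \<gamma>) [r + 1..<length \<mu> + 1])) =
      (\<Sum>p\<le>n. \<Sum>\<gamma>\<in>completions \<mu> (\<delta> @ [h p]). prod_list (map (?w \<gamma>) [r + 1..<length \<mu> + 1]))"
    using IH(1) by (simp_all add: sum.UNION_disjoint del: upt_Suc)
  note this(1)
  moreover have "(\<Sum>\<gamma>\<in>completions \<mu> \<delta>. prod_list (map (?w \<gamma>) [r + 1..<length \<mu> + 1])) =
      row_det (drop r \<mu>) (columns_of \<nu> (Suc r))"
  proof -
    have upt: "[r + 1..<length \<mu> + 1] = Suc r # [r + 2..<length \<mu> + 1]"
      using r by (simp add: upt_conv_Cons del: upt_Suc)
    have "(\<Sum>\<gamma>\<in>completions \<mu> (\<delta> @ [h p]). prod_list (map (?w \<gamma>) [r + 1..<length \<mu> + 1])) =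
        (-1) ^ p * (H (\<mu> ! r + columns_of \<nu> (Suc r) p) *
          row_det (drop (Suc r) \<mu>) (\<lambda>j. columns_of \<nu> (Suc r) (skip p j) - 1))" if "p \<le> n" for p
      unfolding upt IH(2)[OF that, symmetric] list.map prod_list.Cons mult.assoc[symmetric] sum_distrib_left
      by (intro sum.cong refl) (subst first, auto)
    then show ?thesis
      unfolding sum Cons_nth_drop_Suc[OF r, symmetric] row_det.simps n_def[symmetric] by simp
  qed
  ultimately show ?case
    by (simp add: r_def \<nu>_def)
qed

theorem theorem1p1:
  fixes k :: nat and \<mu> :: "int list"
  assumes "k \<ge> 1" and "length \<mu> = k"
  shows "(immaculate \<mu> :: 'a::field_char_0 nsym) =
    (\<Sum>\<gamma>\<in>THC \<mu>. prod_list (map (\<lambda>r. of_int (hook_sign r (\<gamma> ! (r - 1))) *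
                                      H (hook_value \<mu> (nu \<gamma> (r - 1)) r (\<gamma> ! (r - 1)))) [1..<k+1]))"
proof -
  have "nu [] 0 = (\<lambda>i. 0)"
    by (simp add: fun_eq_iff)
  then have "columns_of (nu [] 0) 1 = int" "descending 1 (length \<mu>) (nu [] 0)"
    by (simp_all add: columns_of_def descending_def fun_eq_iff)
  then show ?thesis
    using sum_completions[where ?'a = 'a, of \<mu> "[]"] assms(2)
    by (simp add: immaculate_eq_row_det THC_empty_completions partial_covering_def del: upt_Suc nu.simps)
qed

end
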